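(* Let $\mathbb{K}$ be a field of characteristic different from two and $V$ a finite-dimensional vector space over $\mathbb{K}$. Let $\sigma=(Q,p_0;p_1,\dots,p_n)$ be an $n$-dimensional sector at centre $p_0$ of a quadric $Q\subseteq V$ with external centre $p_0$. Let $\varphi$ be the polar form of a quadratic form $q$ on $V$ such that $Q=\{x\in V\mid q(x-p_0)=1\}$, and let $\sigma_{ij}:=\varphi(p_i-p_0,p_j-p_0)$ for all $i,j\in\{1,\dots,n\}$. Then $S:=(\sigma_{ij})$ is the unique symmetric $n\times n$ matrix over $\mathbb{K}$ such that $\Phi_\sigma^{-1}(Q)=\{x\in\mathbb{K}^n\mid xSx^t=1\}$. Moreover $\sigma_{ii}=1$ for all $i\in\{1,\dots,n\}$.
   Context: A quadric of $V$ is a non-empty set $Q=\{x\in V\mid q(x)+l(x)+\gamma=0\}$ with a quadratic form $q:V\to\mathbb{K}$, a linear form $l:V\to\mathbb{K}$ and $\gamma\in\mathbb{K}$. A point $c\in V$ is a centre of $Q$ if $2c-x\in Q$ for all $x\in Q$; it is an external centre if moreover $c\notin Q$. If $p_0$ is an external centre of $Q$, there is a quadratic form $q$ with $Q=\{x\in V\mid q(x-p_0)=1\}$. The polar form of $q$ is the symmetric bilinear form $\varphi(x,y)=(q(x+y)-q(x)-q(y))/2$. An $n$-dimensional sector at centre $p_0$ of $Q$ is a tuple $\sigma=(Q,p_0;p_1,\dots,p_n)$ where $p_0$ is an external centre of $Q$ and $p_1,\dots,p_n\in Q$ are such that $p_1-p_0,\dots,p_n-p_0$ are linearly independent. Its frame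 affinity is $\Phi_\sigma:\mathbb{K}^n\to V$, $\Phi_\sigma(x_1,\dots,x_n):=p_0+\sum_{i=1}^n x_i(p_i-p_0)$. Elements of $\mathbb{K}^n$ are row vectors and $x^t$ is the transpose. *)

theory Defs
  imports Jordan_Normal_Form.Matrix
begin

text \<open>The vector space \<open>V\<close> is the type \<open>'v\<close> with scalar multiplication \<open>scale\<close>.\<close>

definition bilinear_form :: "('k::field \<Rightarrow> 'v::ab_group_add \<Rightarrow> 'v) \<Rightarrow> ('v \<Rightarrow> 'v \<Rightarrow> 'k) \<Rightarrow> bool"
  where "bilinear_form scale b \<longleftrightarrow>
    (\<forall>x. Vector_Spaces.linear scale (*) (\<lambda>y. b x y)) \<and>
    (\<forall>y. Vector_Spaces.linear scale (*) (\<lambda>x. b x y))"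

definition quadratic_form :: "('k::field \<Rightarrow> 'v::ab_group_add \<Rightarrow> 'v) \<Rightarrow> ('v \<Rightarrow> 'k) \<Rightarrow> bool"
  where "quadratic_form scale q \<longleftrightarrow>
    (\<forall>a x. q (scale a x) = a\<^sup>2 * q x) \<and>
    bilinear_form scale (\<lambda>x y. q (x + y) - q x - q y)"

definition polar_form :: "('v::ab_group_add \<Rightarrow> 'k::field) \<Rightarrow> 'v \<Rightarrow> 'v \<Rightarrow> 'k"
  where "polar_form q x y = (q (x + y) - q x - q y) / 2"

definition quadric :: "('k::field \<Rightarrow> 'v::ab_group_add \<Rightarrow> 'v) \<Rightarrow> 'v set \<Rightarrow> bool"
  where "quadric scale Q \<longleftrightarrow> Q \<noteq> {} \<and>
    (\<exists>q l \<gamma>. quadratic_form scale q \<and> Vector_Spaces.linear scale (*) l \<and>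
      Q = {x. q x + l x + \<gamma> = 0})"

definition centre :: "('k::field \<Rightarrow> 'v::ab_group_add \<Rightarrow> 'v) \<Rightarrow> 'v set \<Rightarrow> 'v \<Rightarrow> bool"
  where "centre scale Q c \<longleftrightarrow> (\<forall>x\<in>Q. scale 2 c - x \<in> Q)"

definition external_centre :: "('k::field \<Rightarrow> 'v::ab_group_add \<Rightarrow> 'v) \<Rightarrow> 'v set \<Rightarrow> 'v \<Rightarrow> bool"
  where "external_centre scale Q c \<longleftrightarrow> centre scale Q c \<and> c \<notin> Q"

text \<open>A tuple \<open>(p\<^sub>0; p\<^sub>1, \<dots>, p\<^sub>n)\<close> is a function on \<open>nat\<close>, of which only the values at
  \<open>0, \<dots>, n\<close> matter. Since \<open>module.dependent\<close> is a predicate on sets, linear independence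
  of the family \<open>p\<^sub>1 - p\<^sub>0, \<dots>, p\<^sub>n - p\<^sub>0\<close> additionally requires injectivity.\<close>

definition sector_at_centre ::
    "('k::field \<Rightarrow> 'v::ab_group_add \<Rightarrow> 'v) \<Rightarrow> nat \<Rightarrow> 'v set \<Rightarrow> (nat \<Rightarrow> 'v) \<Rightarrow> bool"
  where "sector_at_centre scale n Q p \<longleftrightarrow>
    quadric scale Q \<and> external_centre scale Q (p 0) \<and>
    (\<forall>i\<in>{1..n}. p i \<in> Q) \<and>
    inj_on (\<lambda>i. p i - p 0) {1..n} \<and>
    \<not> module.dependent scale ((\<lambda>i. p i - p 0) ` {1..n})"

text \<open>Vectors and matrices of \<open>Jordan_Normal_Form\<close> are indexed from \<open>0\<close>, so the coordinate
  \<open>x\<^sub>i\<close> is \<open>x $ (i - 1)\<close> for \<open>1 \<le> i \<le> n\<close>, and the entry \<open>\<sigma>\<^sub>i\<^sub>j\<close> sits at \<open>(i - 1, j - 1)\<close>.\<close>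

definition frame_affinity ::
    "('k::field \<Rightarrow> 'v::ab_group_add \<Rightarrow> 'v) \<Rightarrow> nat \<Rightarrow> (nat \<Rightarrow> 'v) \<Rightarrow> 'k vec \<Rightarrow> 'v"
  where "frame_affinity scale n p x = p 0 + (\<Sum>i=1..n. scale (x $ (i - 1)) (p i - p 0))"

definition symmetric_matrix :: "nat \<Rightarrow> 'k mat \<Rightarrow> bool"
  where "symmetric_matrix n S \<longleftrightarrow> S \<in> carrier_mat n n \<and> transpose_mat S = S"

text \<open>\<open>x S x\<^sup>t\<close> for a row vector \<open>x\<close>; the \<open>1 \<times> 1\<close> product is identified with its entry.\<close>

definition row_form :: "'k::field mat \<Rightarrow> 'k vec \<Rightarrow> 'k"
  where "row_form S x = (mat_of_row x * S * transpose_mat (mat_of_row x)) $$ (0, 0)"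

end

theory Submission
  imports Defs
begin

text \<open>Why the theorem holds. Bilinearity of the polar form \<open>\<phi>\<close>, together with \<open>\<phi> v v = q v\<close>,
  expands \<open>q\<close> on a linear combination of the \<open>p\<^sub>i - p\<^sub>0\<close> as the quadratic polynomial with Gram matrix \<open>S\<close>
  (\<open>quadratic_form_sum\<close>). This is the membership condition for \<open>\<Phi>\<^sub>\<sigma> x \<in> Q\<close>, and the
  diagonal of \<open>S\<close> is \<open>q (p\<^sub>i - p\<^sub>0) = 1\<close> because \<open>p\<^sub>i \<in> Q\<close>.

  Uniqueness is a statement about matrices alone (\<open>row_form_level_set_inj\<close>), and it works over every
  field in which \<open>2 \<noteq> 0\<close>, however small. A symmetric matrix whose level set \<open>{x. x T x\<^sup>t = 1}\<close> contains
  the unit vectors has ones on the diagonal. The affine line \<open>e\<^sub>i + y e\<^sub>j\<close> then meets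
  the level set where \<open>1 + 2 T\<^sub>i\<^sub>j y + y\<^sup>2 = 1\<close>, that is, exactly for \<open>y = 0\<close> and \<open>y = - 2 T\<^sub>i\<^sub>j\<close>. So the
  level set determines the off-diagonal entries as well, the case of a tangent line being \<open>T\<^sub>i\<^sub>j = 0\<close>.\<close>

lemma two_neq_zero_if_CHAR_neq_2:
  assumes "CHAR('k::field) \<noteq> 2"
  shows "(2::'k) \<noteq> 0"
proof
  assume "(2::'k) = 0"
  then have "of_nat 2 = (0::'k)" by simp
  then have "CHAR('k) dvd 2" using of_nat_eq_0_iff_char_dvd by blast
  then have "CHAR('k) = 1"
    using assms dvd_imp_le[of "CHAR('k)" 2] by (cases "CHAR('k)") auto
  then show False by simp
qed

lemma polar_form_commute: "polar_form q x y = polar_form q y x"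
  by (simp add: polar_form_def add.commute)

lemma polar_form_sum_scale_left:
  assumes "quadratic_form scale q"
  shows "polar_form q (\<Sum>i\<in>I. scale (a i) (v i)) y = (\<Sum>i\<in>I. a i * polar_form q (v i) y)"
proof -
  interpret L: Vector_Spaces.linear scale "(*)" "\<lambda>x. q (x + y) - q x - q y"
    using assms by (simp add: quadratic_form_def bilinear_form_def)
  show ?thesis
    by (simp add: polar_form_def L.sum L.scale sum_divide_distrib)
qed

lemma polar_form_self:
  assumes two: "(2::'k::field) \<noteq> 0"
    and q: "quadratic_form (scale :: 'k \<Rightarrow> 'v::ab_group_add \<Rightarrow> 'v) q"
  shows "polar_form q v v = q v"
proof -
  interpret L: Vector_Spaces.linear scale "(*)" "\<lambda>x. q (x + v) - q x - q v"
    using q by (simp add: quadratic_form_def bilinear_form_def)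
  have "v + v = scale (1 + 1) v"
    by (simp only: L.vs1.scale_left_distrib L.vs1.scale_one)
  then have "q (v + v) = 2 * 2 * q v"
    using q by (simp add: quadratic_form_def power2_eq_square)
  then show ?thesis
    using two by (simp add: polar_form_def field_simps)
qed

lemma quadratic_form_sum:
  assumes two: "(2::'k::field) \<noteq> 0"
    and q: "quadratic_form (scale :: 'k \<Rightarrow> 'v::ab_group_add \<Rightarrow> 'v) q"
  shows "q (\<Sum>i\<in>I. scale (a i) (v i)) =
    (\<Sum>i\<in>I. \<Sum>j\<in>I. a i * polar_form q (v i) (v j) * a j)"
proof -
  let ?w = "\<Sum>i\<in>I. scale (a i) (v i)"
  have "q ?w = polar_form q ?w ?w"
    by (rule polar_form_self[OF two q, symmetric])
  also have "\<dots> = (\<Sum>i\<in>I. a i * polar_form q (v i) ?w)"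
    by (rule polar_form_sum_scale_left[OF q])
  also have "\<dots> = (\<Sum>i\<in>I. a i * (\<Sum>j\<in>I. a j * polar_form q (v j) (v i)))"
    by (subst polar_form_commute) (simp only: polar_form_sum_scale_left[OF q])
  also have "\<dots> = (\<Sum>i\<in>I. \<Sum>j\<in>I. a i * polar_form q (v i) (v j) * a j)"
    by (simp add: sum_distrib_left polar_form_commute mult_ac)
  finally show ?thesis .
qed

lemma row_form_eq_scalar_prod:
  assumes "A \<in> carrier_mat n n" "x \<in> carrier_vec n"
  shows "row_form A x = x \<bullet> (A *\<^sub>v x)"
proof -
  have "row_form A x = (mat_of_row x * (A * transpose_mat (mat_of_row x))) $$ (0, 0)"
    unfolding row_form_def
    by (subst assoc_mult_mat[of _ 1 n _ n _ 1]) (use assms in auto)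
  also have "\<dots> = x \<bullet> col (A * transpose_mat (mat_of_row x)) 0"
    using assms by simp
  also have "col (A * transpose_mat (mat_of_row x)) 0 = A *\<^sub>v x"
    using assms by (subst col_mult2[of _ n n _ 1]) auto
  finally show ?thesis .
qed

lemma row_form_eq_sum:
  assumes "A \<in> carrier_mat n n" "x \<in> carrier_vec n"
  shows "row_form A x = (\<Sum>i<n. \<Sum>j<n. x $ i * A $$ (i, j) * x $ j)"
  unfolding row_form_eq_scalar_prod[OF assms]
  using assms by (auto simp: scalar_prod_def sum_distrib_left mult.assoc atLeast0LessThan intro!: sum.cong)

lemma mult_mat_vec_unit_vec:
  fixes A :: "'k::field mat"
  assumes "A \<in> carrier_mat m n" "i < n"
  shows "A *\<^sub>v unit_vec n i = col A i"
  using assms by (intro eq_vecI) (auto simp: scalar_prod_right_unit[of _ n])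

lemma row_form_unit_vec:
  assumes "A \<in> carrier_mat n n" "i < n"
  shows "row_form A (unit_vec n i) = A $$ (i, i)"
  using assms by (simp add: row_form_eq_scalar_prod[of _ n] mult_mat_vec_unit_vec)

lemma row_form_unit_vec_line:
  assumes A: "symmetric_matrix n A" and ij: "i < n" "j < n"
  shows "row_form A (unit_vec n i + y \<cdot>\<^sub>v unit_vec n j) =
    A $$ (i, i) + 2 * A $$ (i, j) * y + A $$ (j, j) * y\<^sup>2"
proof -
  have carr: "A \<in> carrier_mat n n" and trans: "transpose_mat A = A"
    using A by (auto simp: symmetric_matrix_def)
  have "A $$ (j, i) = transpose_mat A $$ (i, j)"
    using carr ij by simp
  then have sym: "A $$ (j, i) = A $$ (i, j)"
    by (simp add: trans)
  have "A *\<^sub>v (unit_vec n i + y \<cdot>\<^sub>v unit_vec n j) = col A i + y \<cdot>\<^sub>v col A j"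
    using carr ij by (simp add: mult_add_distrib_mat_vec[of _ n n] mult_mat_vec[of _ n n] mult_mat_vec_unit_vec)
  then have "row_form A (unit_vec n i + y \<cdot>\<^sub>v unit_vec n j) =
      (unit_vec n i + y \<cdot>\<^sub>v unit_vec n j) \<bullet> (col A i + y \<cdot>\<^sub>v col A j)"
    using carr by (simp add: row_form_eq_scalar_prod[of _ n])
  also have "\<dots> = A $$ (i, i) + A $$ (i, j) * y + (y * A $$ (j, i) + y * (y * A $$ (j, j)))"
    using carr ij
    by (simp add: add_scalar_prod_distrib[of _ n] algebra_simps)
  finally show ?thesis
    by (simp add: sym power2_eq_square algebra_simps)
qed

lemma row_form_unit_vec_line_eq_1_iff:
  assumes A: "symmetric_matrix n A" and ij: "i < n" "j < n"
    and diag: "A $$ (i, i) = 1" "A $$ (j, j) = 1"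
  shows "row_form A (unit_vec n i + y \<cdot>\<^sub>v unit_vec n j) = 1 \<longleftrightarrow> y = 0 \<or> y = - 2 * A $$ (i, j)"
proof -
  have "row_form A (unit_vec n i + y \<cdot>\<^sub>v unit_vec n j) - 1 = y * (y + 2 * A $$ (i, j))"
    by (simp add: row_form_unit_vec_line[OF A ij] diag power2_eq_square algebra_simps)
  then show ?thesis
    by (metis add_eq_0_iff2 eq_iff_diff_eq_0 minus_mult_left mult_eq_0_iff)
qed

text \<open>The diagonal hypothesis on one of the two matrices passes to the other, because
  it says that the unit vectors lie in the common level set. Afterwards, the lines \<open>e\<^sub>i + y e\<^sub>j\<close> give
  \<open>{0, - 2 A\<^sub>i\<^sub>j} = {0, - 2 B\<^sub>i\<^sub>j}\<close>.\<close>

lemma row_form_level_set_inj: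
  fixes A B :: "'k::field mat"
  assumes two: "(2::'k) \<noteq> 0"
    and A: "symmetric_matrix n A" and B: "symmetric_matrix n B"
    and diag: "\<And>i. i < n \<Longrightarrow> A $$ (i, i) = 1"
    and level: "{x \<in> carrier_vec n. row_form A x = 1} = {x \<in> carrier_vec n. row_form B x = 1}"
  shows "A = B"
proof (rule eq_matI)
  have carr: "A \<in> carrier_mat n n" "B \<in> carrier_mat n n"
    using A B by (auto simp: symmetric_matrix_def)
  then show "dim_row A = dim_row B" "dim_col A = dim_col B"
    by auto
  have eq: "row_form A x = 1 \<longleftrightarrow> row_form B x = 1" if "x \<in> carrier_vec n" for x
    using level that by blast
  have diagB: "B $$ (i, i) = 1" if "i < n" for i
    using eq[of "unit_vec n i"] diag[OF that] that carr by (simp add: row_form_unit_vec)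
  fix i j assume "i < dim_row B" "j < dim_col B"
  then have ij: "i < n" "j < n"
    using carr by auto
  have "y = 0 \<or> y = - 2 * A $$ (i, j) \<longleftrightarrow> y = 0 \<or> y = - 2 * B $$ (i, j)" for y
    using eq[of "unit_vec n i + y \<cdot>\<^sub>v unit_vec n j"] ij
    by (simp add: row_form_unit_vec_line_eq_1_iff A B diag diagB)
  from this[of "- 2 * A $$ (i, j)"] this[of "- 2 * B $$ (i, j)"]
  show "A $$ (i, j) = B $$ (i, j)"
    using two by auto
qed

theorem proposition2p6:
  fixes scale :: "'k::field \<Rightarrow> 'v::ab_group_add \<Rightarrow> 'v"
    and Basis Q :: "'v set"
    and n :: nat
    and p :: "nat \<Rightarrow> 'v"
    and q :: "'v \<Rightarrow> 'k"
    and \<phi> :: "'v \<Rightarrow> 'v \<Rightarrow> 'k"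
    and \<sigma> :: "nat \<Rightarrow> nat \<Rightarrow> 'k"
    and S :: "'k mat"
  assumes char: "CHAR('k) \<noteq> 2"
    and V: "finite_dimensional_vector_space scale Basis"
    and sector: "sector_at_centre scale n Q p"
    and q: "quadratic_form scale q"
    and Q_eq: "Q = {x. q (x - p 0) = 1}"
    and \<phi>: "\<phi> = polar_form q"
    and \<sigma>: "\<And>i j. i \<in> {1..n} \<Longrightarrow> j \<in> {1..n} \<Longrightarrow> \<sigma> i j = \<phi> (p i - p 0) (p j - p 0)"
    and S: "S = mat n n (\<lambda>(i, j). \<sigma> (i + 1) (j + 1))"
  shows "(symmetric_matrix n S \<and>
          {x \<in> carrier_vec n. frame_affinity scale n p x \<in> Q} = {x \<in> carrier_vec n. row_form S x = 1}) \<and>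
         (\<forall>T. symmetric_matrix n T \<and>
            {x \<in> carrier_vec n. frame_affinity scale n p x \<in> Q} = {x \<in> carrier_vec n. row_form T x = 1}
            \<longrightarrow> T = S) \<and>
         (\<forall>i\<in>{1..n}. \<sigma> i i = 1)"
proof -
  have two: "(2::'k) \<noteq> 0"
    using char by (rule two_neq_zero_if_CHAR_neq_2)
  have S_carr: "S \<in> carrier_mat n n"
    by (simp add: S)
  have S_entry: "S $$ (i, j) = polar_form q (p (i + 1) - p 0) (p (j + 1) - p 0)" if "i < n" "j < n" for i j
    using that by (simp add: S \<sigma> \<phi>)
  have S_sym: "symmetric_matrix n S"
    unfolding symmetric_matrix_def
    by (intro conjI eq_matI) (use S_carr in \<open>auto simp: S_entry polar_form_commute\<close>)
  have \<sigma>_diag: "\<sigma> i i = 1" if "i \<in> {1..n}" for i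
  proof -
    have "p i \<in> Q"
      using sector that unfolding sector_at_centre_def by blast
    then show ?thesis
      using that by (simp add: \<sigma> \<phi> polar_form_self[OF two q] Q_eq)
  qed
  have pullback: "frame_affinity scale n p x \<in> Q \<longleftrightarrow> row_form S x = 1" if x: "x \<in> carrier_vec n" for x
  proof -
    have "frame_affinity scale n p x - p 0 = (\<Sum>i<n. scale (x $ i) (p (i + 1) - p 0))"
      unfolding frame_affinity_def
      by (simp add: sum.atLeast1_atMost_eq)
    then have "q (frame_affinity scale n p x - p 0) = row_form S x"
      by (simp add: quadratic_form_sum[OF two q] row_form_eq_sum[OF S_carr x] S_entry)
    then show ?thesis
      by (simp add: Q_eq)
  qed
  then have level: "{x \<in> carrier_vec n. frame_affinity scale n p x \<in> Q} =
      {x \<in> carrier_vec n. row_form S x = 1}"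
    by blast
  moreover have "S $$ (i, i) = 1" if "i < n" for i
    using \<sigma>_diag[of "i + 1"] that by (simp add: S)
  then have "T = S" if "symmetric_matrix n T"
    "{x \<in> carrier_vec n. row_form S x = 1} = {x \<in> carrier_vec n. row_form T x = 1}" for T
    using row_form_level_set_inj[OF two S_sym that(1) _ that(2)] by simp
  ultimately show ?thesis
    using S_sym \<sigma>_diag by simp
qed

end
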